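(* Let $n\geq 3$. A color graph associated to a polygon with $n$ sides can be embedded in a hypercube of dimension no greater than $\left\lfloor \frac{n(3n-8)}{16}\right\rfloor$.
   Context: Let $V=\mathbb{Z}_2\times\mathbb{Z}_2$ be the Klein four-group with elements $0,1,2,3$ ($1+2+3=0$, $x+x=0$). A color graph associated to a polygon with $n$ sides is defined as follows: the vertices of a convex $n$-gon $P$ are colored by elements of $V$ so that adjacent polygon vertices have different colors; a triangulation of $P$ (using only the vertices of $P$) is compatible with the coloring if every diagonal of the triangulation joins differently colored vertices; the color graph has as vertices the compatible triangulations, two being adjacent iff they differ by a single diagonal flip. For a finite set $S$ with $|S|=k$, the $k$-dimensional hypercube $\mathcal{H}(S)$ has vertex set the power set of $S$, with $A,B$ adjacent iff $A\Delta B$ is a singleton. A graph embeds in a hypercube if it is isomorphic to a subgraph of it. *)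

theory Defs
  imports Complex_Main "HOL-Library.Z2" "HOL-Library.Product_Plus"
begin

type_synonym klein_four = "bit \<times> bit"

text \<open>
  The vertices of a convex polygon with \<open>n\<close> sides are the numbers \<open>0, \<dots>, n - 1\<close> in cyclic
  order along its boundary; an edge or diagonal is the two-element set of its end points.
\<close>

definition polygon_sides :: "nat \<Rightarrow> nat set set" where
  "polygon_sides n = {{i, Suc i mod n} | i. i < n}"

definition polygon_diagonals :: "nat \<Rightarrow> nat set set" where
  "polygon_diagonals n = {{i, j} | i j. i < n \<and> j < n \<and> i \<noteq> j} - polygon_sides n"

text \<open>
  Two diagonals of a convex polygon meet in their interiors iff their end points alternate
  along the boundary.
\<close>

definition crosses :: "nat set \<Rightarrow> nat set \<Rightarrow> bool" where
  "crosses d e \<longleftrightarrow> (\<exists>i j k l. i < j \<and> j < k \<and> k < l \<and>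
     (d = {i, k} \<and> e = {j, l} \<or> d = {j, l} \<and> e = {i, k}))"

definition noncrossing :: "nat set set \<Rightarrow> bool" where
  "noncrossing T \<longleftrightarrow> (\<forall>d\<in>T. \<forall>e\<in>T. \<not> crosses d e)"

definition triangulation :: "nat \<Rightarrow> nat set set \<Rightarrow> bool" where
  "triangulation n T \<longleftrightarrow> T \<subseteq> polygon_diagonals n \<and> noncrossing T \<and>
     (\<forall>d \<in> polygon_diagonals n - T. \<not> noncrossing (insert d T))"

text \<open>
  A flip replaces a diagonal of \<open>T\<close> by the other diagonal of the quadrilateral formed by the
  two triangles of \<open>T\<close> that share it.
\<close>

definition flip :: "nat \<Rightarrow> nat set set \<Rightarrow> nat set set \<Rightarrow> bool" where
  "flip n T T' \<longleftrightarrow> (\<exists>i j k l. i < j \<and> j < k \<and> k < l \<and> l < n \<and>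
     {{i, j}, {j, k}, {k, l}, {l, i}} \<subseteq> polygon_sides n \<union> T \<and>
     ({i, k} \<in> T \<and> T' = insert {j, l} (T - {{i, k}}) \<or>
      {j, l} \<in> T \<and> T' = insert {i, k} (T - {{j, l}})))"

definition properly_colored :: "(nat \<Rightarrow> 'c) \<Rightarrow> nat set set \<Rightarrow> bool" where
  "properly_colored c E \<longleftrightarrow> (\<forall>i j. {i, j} \<in> E \<longrightarrow> c i \<noteq> c j)"

definition polygon_coloring :: "nat \<Rightarrow> (nat \<Rightarrow> klein_four) \<Rightarrow> bool" where
  "polygon_coloring n c \<longleftrightarrow> properly_colored c (polygon_sides n)"

definition compatible_triangulations :: "nat \<Rightarrow> (nat \<Rightarrow> klein_four) \<Rightarrow> nat set set set" where
  "compatible_triangulations n c = {T. triangulation n T \<and> properly_colored c T}"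

text \<open>A simple graph is the pair of its vertex set and its set of (two-element) edges.\<close>

type_synonym 'a graph = "'a set \<times> 'a set set"

definition color_graph :: "nat \<Rightarrow> (nat \<Rightarrow> klein_four) \<Rightarrow> nat set set graph" where
  "color_graph n c = (compatible_triangulations n c,
     {{T, T'} | T T'. T \<in> compatible_triangulations n c \<and>
        T' \<in> compatible_triangulations n c \<and> flip n T T'})"

definition hypercube :: "'a set \<Rightarrow> 'a set graph" where
  "hypercube S = (Pow S, {{A, B} | A B. A \<in> Pow S \<and> B \<in> Pow S \<and> is_singleton (sym_diff A B)})"

definition subgraph :: "'a graph \<Rightarrow> 'a graph \<Rightarrow> bool" where
  "subgraph H G \<longleftrightarrow> fst H \<subseteq> fst G \<and> snd H \<subseteq> snd G \<and> \<Union> (snd H) \<subseteq> fst H"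

definition graph_isomorphic :: "'a graph \<Rightarrow> 'b graph \<Rightarrow> bool" where
  "graph_isomorphic G H \<longleftrightarrow> (\<exists>f. bij_betw f (fst G) (fst H) \<and>
     (\<forall>u \<in> fst G. \<forall>v \<in> fst G. {u, v} \<in> snd G \<longleftrightarrow> {f u, f v} \<in> snd H))"

definition graph_embeds :: "'a graph \<Rightarrow> 'b graph \<Rightarrow> bool" where
  "graph_embeds G K \<longleftrightarrow> (\<exists>H. subgraph H K \<and> graph_isomorphic G H)"

end

theory Submission
  imports Defs
begin

text \<open>
  Fix a color \<open>v\<close> and send a compatible triangulation to the set of its diagonals that have no
  end point of color \<open>v\<close>. A flip takes place in a quadrilateral whose corners carry all four colors,
  so exactly one of the two diagonals involved avoids \<open>v\<close> and the image changes by one element.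
  The map is injective: if a diagonal at a vertex \<open>p\<close> of color \<open>v\<close> is missing from the
  triangulation, then it crosses the side opposite \<open>p\<close> of some triangle at \<open>p\<close>, and that
  side avoids \<open>v\<close>; hence the diagonals avoiding \<open>v\<close> determine all the others.
  Each properly colored diagonal avoids two of the four colors, so for some \<open>v\<close> at most half of
  them avoid \<open>v\<close>. There are at most \<open>3n\<^sup>2/8 - n\<close> of them, as a 4-coloring of \<open>n\<close> points has
  at most \<open>3n\<^sup>2/8\<close> bichromatic pairs and the \<open>n\<close> sides are among these.
\<close>

section \<open>Crossing in coordinates and cyclic renumbering\<close>

lemma crosses_iff:
  "crosses {a, b} {x, y} \<longleftrightarrow>
     min a b < min x y \<and> min x y < max a b \<and> max a b < max x y \<or>
     min x y < min a b \<and> min a b < max x y \<and> max x y < max a b"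
proof
  assume "crosses {a, b} {x, y}"
  then show "min a b < min x y \<and> min x y < max a b \<and> max a b < max x y \<or>
     min x y < min a b \<and> min a b < max x y \<and> max x y < max a b"
    unfolding crosses_def doubleton_eq_iff by (elim exE conjE disjE) auto
next
  have eq: "{a, b} = {min a b, max a b}" "{x, y} = {min x y, max x y}"
    by (auto simp: min_def max_def)
  assume "min a b < min x y \<and> min x y < max a b \<and> max a b < max x y \<or>
     min x y < min a b \<and> min a b < max x y \<and> max x y < max a b"
  then show "crosses {a, b} {x, y}"
    unfolding crosses_def using eq by blast
qed

lemma crosses_commute: "crosses d e \<longleftrightarrow> crosses e d"
  unfolding crosses_def by blast

text \<open>The position of \<open>z\<close> when the polygon is renumbered cyclically starting from \<open>p\<close>.\<close>

definition rot :: "nat \<Rightarrow> nat \<Rightarrow> nat \<Rightarrow> nat" where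
  "rot n p z = (if p \<le> z then z - p else z + n - p)"

lemma rot_inj: "\<lbrakk>p < n; x < n; y < n; rot n p x = rot n p y\<rbrakk> \<Longrightarrow> x = y"
  by (auto simp: rot_def split: if_splits)

lemma rot_less_iff:
  "\<lbrakk>p < n; x < n; y < n\<rbrakk> \<Longrightarrow>
    rot n p x < rot n p y \<longleftrightarrow> (if p \<le> x then y < p \<or> x < y else y < p \<and> x < y)"
  by (auto simp: rot_def)

text \<open>Alternation along the boundary does not depend on where the numbering starts, so
  arguments at a vertex \<open>p\<close> may put \<open>p\<close> at position 0.\<close>

lemma crosses_rot:
  assumes "p < n" "a < n" "b < n" "x < n" "y < n"
  shows "crosses {rot n p a, rot n p b} {rot n p x, rot n p y} \<longleftrightarrow> crosses {a, b} {x, y}"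
  using assms unfolding crosses_iff max_less_iff_conj less_max_iff_disj
    min_less_iff_disj min_less_iff_conj
  by (cases "p \<le> a"; cases "p \<le> b"; cases "p \<le> x"; cases "p \<le> y";
      simp add: rot_less_iff; linarith?)

section \<open>Sides and triangles of a triangulation\<close>

lemma side_doubleton_cases:
  assumes "s \<in> polygon_sides n"
  obtains i where "Suc i < n" "s = {i, Suc i}" | "0 < n" "s = {n - 1, 0}"
proof -
  obtain i where i: "i < n" "s = {i, Suc i mod n}"
    using assms by (auto simp: polygon_sides_def)
  show thesis
  proof (cases "Suc i < n")
    case True
    then show thesis using i that(1) by simp
  next
    case False
    then have "i = n - 1" "Suc i mod n = 0" using i
      by (auto simp: not_less) (metis Suc_leI le_antisym mod_self)
    then show thesis using i that(2) by auto
  qed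
qed

text \<open>One of the two boundary arcs between the ends of a side contains no further
  vertex.\<close>

lemma side_not_crosses:
  assumes "s \<in> polygon_sides n" "u < n" "w < n"
  shows "\<not> crosses s {u, w}"
  using assms(1)
proof (cases rule: side_doubleton_cases)
  case (1 i)
  then show ?thesis by (auto simp: crosses_iff min_def max_def)
next
  case 2
  then show ?thesis using assms by (auto simp: crosses_iff min_def max_def)
qed

lemma diagonalE:
  assumes "d \<in> polygon_diagonals n"
  obtains i j where "d = {i, j}" "i < n" "j < n" "i \<noteq> j" "{i, j} \<notin> polygon_sides n"
  using assms unfolding polygon_diagonals_def by blast

text \<open>
  Here \<open>x\<close> and \<open>y\<close> are the neighbors of \<open>p\<close> closest to \<open>q\<close> on either side: a member of \<open>T\<close>
  crossing \<open>{x, y}\<close> but neither \<open>{p, x}\<close> nor \<open>{p, y}\<close> would end in \<open>p\<close>, giving a closer neighbor.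
\<close>

lemma triangulation_triangle_towards:
  assumes T: "triangulation n T" and d: "{p, q} \<in> polygon_diagonals n" and notin: "{p, q} \<notin> T"
  obtains x y where "{p, x} \<in> polygon_sides n \<union> T" "{p, y} \<in> polygon_sides n \<union> T"
    "{x, y} \<in> T" "crosses {p, q} {x, y}"
proof -
  have pq: "p < n" "q < n" "p \<noteq> q" "{p, q} \<notin> polygon_sides n"
    using d by (auto simp: polygon_diagonals_def doubleton_eq_iff)
  let ?r = "rot n p"
  define N where "N = {z. z < n \<and> z \<noteq> p \<and> {p, z} \<in> polygon_sides n \<union> T}"
  have finN: "finite N" unfolding N_def by auto
  have r0: "?r p = 0" by (simp add: rot_def)
  have rpos: "0 < ?r z" if "z < n" "z \<noteq> p" for z
    using rot_inj[of p n z p] that pq r0 by auto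
  have n: "n > 2"
  proof (rule ccontr)
    assume "\<not> n > 2"
    then have "n = 2" "p = 0 \<and> q = 1 \<or> p = 1 \<and> q = 0" using pq by auto
    then have "{p, q} = {0, Suc 0 mod n}" by auto
    moreover have "{0, Suc 0 mod n} \<in> polygon_sides n"
      using pq(1) unfolding polygon_sides_def by fastforce
    ultimately show False using pq(4) by simp
  qed
  \<comment> \<open>The boundary neighbors \<open>s\<close> and \<open>t\<close> of \<open>p\<close>
    get the first and the last nonzero position; they make \<open>A\<close> and \<open>B\<close>
    below nonempty.\<close>
  define s where "s = Suc p mod n"
  have s: "s \<in> N" "?r s = 1"
  proof -
    have "{p, s} \<in> polygon_sides n" using pq unfolding s_def polygon_sides_def by blast
    moreover have "s = (if Suc p = n then 0 else Suc p)" using pq by (simp add: s_def)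
    ultimately show "s \<in> N" "?r s = 1" using pq n
      by (auto simp: N_def rot_def)
  qed
  define t where "t = (if p = 0 then n - 1 else p - 1)"
  have t: "t \<in> N" "?r t = n - 1"
  proof -
    have t': "t < n" "Suc t mod n = p" using pq by (auto simp: t_def)
    then have "{p, t} \<in> polygon_sides n" unfolding polygon_sides_def by blast
    with t' show "t \<in> N" "?r t = n - 1" using pq n
      by (auto simp: N_def rot_def t_def)
  qed
  have qN: "q \<notin> N" using notin pq by (auto simp: N_def)
  have rq: "?r z \<noteq> ?r q" if "z \<in> N" for z
    using that qN rot_inj[of p n z q] pq by (auto simp: N_def)
  define A where "A = {z \<in> N. ?r z < ?r q}"
  define B where "B = {z \<in> N. ?r q < ?r z}"
  have "?r q < n" using pq by (auto simp: rot_def)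
  have "s \<in> A" using s rq[OF s(1)] rpos[of q] pq by (auto simp: A_def)
  have "t \<in> B" using t rq[OF t(1)] \<open>?r q < n\<close> by (auto simp: B_def)
  obtain x where x: "x \<in> A" and xmax: "\<And>z. z \<in> A \<Longrightarrow> ?r z \<le> ?r x"
  proof -
    have fin: "finite (?r ` A)" "?r ` A \<noteq> {}" using finN \<open>s \<in> A\<close> by (auto simp: A_def)
    obtain x where "x \<in> A" "?r x = Max (?r ` A)" using Max_in[OF fin] by auto
    then show thesis using that[of x] Max_ge[OF fin(1)] by auto
  qed
  obtain y where y: "y \<in> B" and ymin: "\<And>z. z \<in> B \<Longrightarrow> ?r y \<le> ?r z"
  proof -
    have fin: "finite (?r ` B)" "?r ` B \<noteq> {}" using finN \<open>t \<in> B\<close> by (auto simp: B_def)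
    obtain y where "y \<in> B" "?r y = Min (?r ` B)" using Min_in[OF fin] by auto
    then show thesis using that[of y] Min_le[OF fin(1)] by auto
  qed
  have xN: "x < n" "x \<noteq> p" "{p, x} \<in> polygon_sides n \<union> T" "?r x < ?r q"
    using x by (auto simp: A_def N_def)
  have yN: "y < n" "y \<noteq> p" "{p, y} \<in> polygon_sides n \<union> T" "?r q < ?r y"
    using y by (auto simp: B_def N_def)
  have gap: "?r z \<le> ?r x \<or> ?r y \<le> ?r z" if "z \<in> N" for z
    using xmax[of z] ymin[of z] rq[OF that] that by (auto simp: A_def B_def neq_iff)
  have "crosses {?r p, ?r q} {?r x, ?r y}"
    using xN yN rpos[of x] by (auto simp: crosses_iff r0)
  then have cr: "crosses {p, q} {x, y}"
    using crosses_rot pq xN yN by blast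
  have "{x, y} \<notin> polygon_sides n"
    using cr side_not_crosses[of "{x, y}" n p q] pq crosses_commute by blast
  moreover have "x \<noteq> y" using xN yN by auto
  ultimately have xyd: "{x, y} \<in> polygon_diagonals n"
    using xN yN unfolding polygon_diagonals_def by blast
  have TD: "T \<subseteq> polygon_diagonals n" and nc: "noncrossing T"
    using T by (auto simp: triangulation_def)
  have edge: "\<not> crosses e {u, w}" if "e \<in> polygon_sides n \<union> T" "{u, w} \<in> T" "u < n" "w < n" for e u w
    using that side_not_crosses[of e n u w] nc by (auto simp: noncrossing_def)
  \<comment> \<open>If \<open>w\<close> is \<open>p\<close>, then \<open>u\<close> is a neighbor of
    \<open>p\<close> inside the gap; otherwise \<open>{u, w}\<close> crosses \<open>{p, x}\<close>
    or \<open>{p, y}\<close>, depending on the side on which \<open>w\<close> lies.\<close>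
  have oneside: False
    if uw: "{u, w} \<in> T" "u < n" "w < n" and u: "?r x < ?r u" "?r u < ?r y"
      and w: "?r w < ?r x \<or> ?r y < ?r w" for u w
  proof (cases "w = p")
    case True
    then have "u \<in> N" using uw u r0 by (auto simp: N_def insert_commute)
    then show False using gap u by force
  next
    case False
    then have "0 < ?r w" using rpos uw by simp
    then have "crosses {?r p, ?r x} {?r u, ?r w} \<or> crosses {?r p, ?r y} {?r u, ?r w}"
      using u w by (auto simp: crosses_iff r0 min_def max_def)
    then show False
      using crosses_rot edge xN yN uw pq by metis
  qed
  have nx: "\<not> crosses {x, y} e" if "e \<in> T" for e
  proof
    assume c: "crosses {x, y} e"
    obtain u w where e: "e = {u, w}" "u < n" "w < n"
      using \<open>e \<in> T\<close> TD diagonalE by blast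
    have "crosses {?r x, ?r y} {?r u, ?r w}"
      using c crosses_rot e xN yN pq by blast
    then have "?r x < ?r u \<and> ?r u < ?r y \<and> (?r w < ?r x \<or> ?r y < ?r w) \<or>
      ?r x < ?r w \<and> ?r w < ?r y \<and> (?r u < ?r x \<or> ?r y < ?r u)"
      using xN(4) yN(4) by (auto simp: crosses_iff min_def max_def split: if_splits)
    then show False
      using oneside[of u w] oneside[of w u] e that by (auto simp: insert_commute)
  qed
  have "\<not> crosses {x, y} {x, y}" by (auto simp: crosses_iff)
  then have "noncrossing (insert {x, y} T)"
    using nx nc crosses_commute unfolding noncrossing_def by blast
  then have "{x, y} \<in> T"
    using T xyd unfolding triangulation_def by blast
  then show thesis using that xN yN cr by blast
qed

section \<open>Diagonals avoiding a color: injectivity and flips\<close>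

definition avoiding :: "(nat \<Rightarrow> 'c) \<Rightarrow> 'c \<Rightarrow> nat set set \<Rightarrow> nat set set" where
  "avoiding c v E = {d \<in> E. v \<notin> c ` d}"

text \<open>The corners \<open>x\<close> and \<open>y\<close> of the triangle crossed by a missing
  \<open>{p, q}\<close> are joined to \<open>p\<close> by sides or members of \<open>T\<close>, so
  neither has the color \<open>v\<close> of \<open>p\<close>.\<close>

lemma mem_triangulation_iff_avoiding:
  assumes col: "properly_colored c (polygon_sides n)"
    and T: "triangulation n T" "properly_colored c T"
    and d: "d \<in> polygon_diagonals n" "v \<in> c ` d"
  shows "d \<in> T \<longleftrightarrow> (\<forall>e \<in> avoiding c v T. \<not> crosses d e)"
proof
  assume "d \<in> T"
  then show "\<forall>e \<in> avoiding c v T. \<not> crosses d e"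
    using T by (auto simp: avoiding_def triangulation_def noncrossing_def)
next
  assume nc: "\<forall>e \<in> avoiding c v T. \<not> crosses d e"
  obtain p q where pq: "d = {p, q}" "c p = v"
    using d by (elim diagonalE) (auto simp: insert_commute)
  show "d \<in> T"
  proof (rule ccontr)
    assume "d \<notin> T"
    then obtain x y where xy: "{p, x} \<in> polygon_sides n \<union> T" "{p, y} \<in> polygon_sides n \<union> T"
      "{x, y} \<in> T" "crosses {p, q} {x, y}"
      using triangulation_triangle_towards[OF T(1)] d(1) pq(1) by metis
    then have "c x \<noteq> v" "c y \<noteq> v"
      using col T(2) pq(2) unfolding properly_colored_def by blast+
    then have "{x, y} \<in> avoiding c v T" using xy by (auto simp: avoiding_def)
    then show False using nc xy pq by blast
  qed
qed

lemma inj_on_avoiding: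
  assumes "polygon_coloring n c"
  shows "inj_on (avoiding c v) (compatible_triangulations n c)"
proof (rule inj_onI)
  fix T T'
  assume T: "T \<in> compatible_triangulations n c" "T' \<in> compatible_triangulations n c"
    and eq: "avoiding c v T = avoiding c v T'"
  have *: "d \<in> T \<longleftrightarrow> d \<in> T'" if "d \<in> polygon_diagonals n" for d
  proof (cases "v \<in> c ` d")
    case True
    then show ?thesis
      using mem_triangulation_iff_avoiding[of c n _ d v] assms that T eq
      by (simp add: polygon_coloring_def compatible_triangulations_def)
  next
    case False
    then have "d \<in> X \<longleftrightarrow> d \<in> avoiding c v X" for X by (simp add: avoiding_def)
    then show ?thesis using eq by blast
  qed
  have "T \<subseteq> polygon_diagonals n" "T' \<subseteq> polygon_diagonals n"
    using T by (auto simp: compatible_triangulations_def triangulation_def)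
  with * show "T = T'" by blast
qed

lemma UNIV_klein_four: "(UNIV :: klein_four set) = {(0,0), (0,1), (1,0), (1,1)}"
proof -
  have "x = 0 \<or> x = 1" for x :: bit by (cases x) auto
  then show ?thesis by auto
qed

lemma card_UNIV_klein_four: "finite (UNIV :: klein_four set)" "card (UNIV :: klein_four set) = 4"
  unfolding UNIV_klein_four by simp_all

lemma flip_avoiding:
  assumes col: "polygon_coloring n c"
    and T: "T \<in> compatible_triangulations n c" "T' \<in> compatible_triangulations n c"
    and "flip n T T'"
  shows "is_singleton (sym_diff (avoiding c v T) (avoiding c v T'))"
proof -
  obtain i j k l where o: "i < j" "j < k" "k < l" "l < n"
    and sides: "{{i, j}, {j, k}, {k, l}, {l, i}} \<subseteq> polygon_sides n \<union> T"
    and ex: "{i, k} \<in> T \<and> T' = insert {j, l} (T - {{i, k}}) \<or>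
      {j, l} \<in> T \<and> T' = insert {i, k} (T - {{j, l}})"
    using \<open>flip n T T'\<close> unfolding flip_def by blast
  have pc: "properly_colored c (polygon_sides n)" "properly_colored c T" "properly_colored c T'"
    using col T by (auto simp: polygon_coloring_def compatible_triangulations_def)
  have pcE: "c a \<noteq> c b" if "{a, b} \<in> polygon_sides n \<union> T \<union> T'" for a b
    using pc that unfolding properly_colored_def by blast
  \<comment> \<open>One diagonal lies in \<open>T\<close> and the other in \<open>T'\<close>;
    together with the four edges, all six pairs of corners are bichromatic.\<close>
  have "{i, k} \<in> T \<union> T'" "{j, l} \<in> T \<union> T'" using ex by auto
  then have ne: "c i \<noteq> c j" "c j \<noteq> c k" "c k \<noteq> c l" "c l \<noteq> c i" "c i \<noteq> c k" "c j \<noteq> c l"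
    using sides by (auto intro!: pcE)
  have "card {c i, c j, c k, c l} = card (UNIV :: klein_four set)"
    using ne by (auto simp: card_UNIV_klein_four)
  then have "{c i, c j, c k, c l} = UNIV"
    using card_UNIV_klein_four(1) by (metis card_subset_eq subset_UNIV)
  then have v: "v \<in> {c i, c j, c k, c l}" by simp
  have one: "v \<in> c ` {i, k} \<longleftrightarrow> v \<notin> c ` {j, l}"
    using v ne by auto
  \<comment> \<open>The inserted diagonal must be new, or the symmetric difference could be
    empty.\<close>
  have "crosses {i, k} {j, l}" using o by (simp add: crosses_iff)
  moreover have "noncrossing T" using T by (simp add: compatible_triangulations_def triangulation_def)
  ultimately have notboth: "\<not> ({i, k} \<in> T \<and> {j, l} \<in> T)"
    unfolding noncrossing_def by blast
  have step: "is_singleton (sym_diff (avoiding c v T) (avoiding c v (insert e (T - {d}))))"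
    if "d \<in> T" "e \<notin> T" "v \<in> c ` d \<longleftrightarrow> v \<notin> c ` e" for d e
  proof -
    have "sym_diff (avoiding c v T) (avoiding c v (insert e (T - {d}))) =
        {if v \<in> c ` d then e else d}"
      using that by (auto simp: avoiding_def)
    then show ?thesis by simp
  qed
  show ?thesis using ex
  proof
    assume "{i, k} \<in> T \<and> T' = insert {j, l} (T - {{i, k}})"
    then show ?thesis using step[of "{i, k}" "{j, l}"] one notboth by blast
  next
    assume "{j, l} \<in> T \<and> T' = insert {i, k} (T - {{j, l}})"
    then show ?thesis using step[of "{j, l}" "{i, k}"] one notboth by blast
  qed
qed

section \<open>Graph embeddings from injective maps\<close>

text \<open>The subgraph consists of the image vertices and image edges only and need not be
  induced, so preservation of edges in one direction suffices.\<close>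

lemma graph_embeds_if_inj_on:
  assumes inj: "inj_on f (fst G)" and verts: "f ` fst G \<subseteq> fst K"
    and edges: "\<And>e. e \<in> snd G \<Longrightarrow> f ` e \<in> snd K" and wf: "\<Union> (snd G) \<subseteq> fst G"
  shows "graph_embeds G K"
proof -
  define H where "H = (f ` fst G, (`) f ` snd G)"
  have "subgraph H K" using verts edges wf by (auto simp: subgraph_def H_def)
  moreover have "{u, v} \<in> snd G \<longleftrightarrow> {f u, f v} \<in> snd H" if "u \<in> fst G" "v \<in> fst G" for u v
  proof
    assume "{u, v} \<in> snd G"
    then have "f ` {u, v} \<in> snd H" unfolding H_def snd_conv by (rule imageI)
    then show "{f u, f v} \<in> snd H" by simp
  next
    assume "{f u, f v} \<in> snd H"
    then obtain e where e: "e \<in> snd G" "f ` {u, v} = f ` e" by (auto simp: H_def)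
    then have "{u, v} = e" using inj_on_image_eq_iff[OF inj, of "{u, v}" e] that wf by blast
    then show "{u, v} \<in> snd G" using e by simp
  qed
  ultimately show ?thesis using inj
    unfolding graph_embeds_def graph_isomorphic_def bij_betw_def
    by (intro exI[of _ H]) (auto simp: H_def)
qed

section \<open>Counting sides and bichromatic pairs\<close>

lemma card_polygon_sides:
  assumes "n \<ge> 3"
  shows "card (polygon_sides n) = n"
proof -
  have "inj_on (\<lambda>i. {i, Suc i mod n}) {..<n}"
  proof (rule inj_onI)
    fix i j assume *: "i \<in> {..<n}" "j \<in> {..<n}" "{i, Suc i mod n} = {j, Suc j mod n}"
    show "i = j"
    proof (rule ccontr)
      assume "i \<noteq> j"
      \<comment> \<open>Distinct vertices that are successors of each other occur only for
        \<open>n = 2\<close>.\<close>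
      then have "i = Suc j mod n" "j = Suc i mod n" using * by (auto simp: doubleton_eq_iff)
      moreover have "Suc m mod n = (if Suc m = n then 0 else Suc m)" if "m < n" for m
        using that by simp
      ultimately show False using * assms by (auto split: if_splits)
    qed
  qed
  moreover have "polygon_sides n = (\<lambda>i. {i, Suc i mod n}) ` {..<n}"
    by (auto simp: polygon_sides_def)
  ultimately show ?thesis by (simp add: card_image)
qed

definition bichromatic_pairs :: "nat \<Rightarrow> (nat \<Rightarrow> 'c) \<Rightarrow> nat set set" where
  "bichromatic_pairs n c = {{i, j} | i j. i < n \<and> j < n \<and> c i \<noteq> c j}"

lemma finite_bichromatic_pairs: "finite (bichromatic_pairs n c)"
  by (rule finite_subset[of _ "Pow {..<n}"]) (auto simp: bichromatic_pairs_def)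

text \<open>Among the \<open>n * n\<close> ordered pairs, the monochromatic ones number the sum of
  the squared class sizes, which is at least a quarter of \<open>n * n\<close> because there are
  four classes.\<close>

lemma card_bichromatic_pairs:
  fixes c :: "nat \<Rightarrow> klein_four"
  shows "8 * card (bichromatic_pairs n c) \<le> 3 * n\<^sup>2"
proof -
  define L where "L = {(i, j). i < j \<and> j < n \<and> c i \<noteq> c j}"
  define M where "M v = {i. i < n \<and> c i = v}" for v
  let ?E = "SIGMA i:{..<n}. M (c i)"
  have finM: "finite (M v)" for v by (simp add: M_def)
  have finL: "finite L" by (rule finite_subset[of _ "{..<n} \<times> {..<n}"]) (auto simp: L_def)
  have "inj_on (\<lambda>(i, j). {i, j}) L" by (auto simp: inj_on_def L_def doubleton_eq_iff)
  moreover have "(\<lambda>(i, j). {i, j}) ` L = bichromatic_pairs n c"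
  proof
    show "(\<lambda>(i, j). {i, j}) ` L \<subseteq> bichromatic_pairs n c"
      by (force simp: L_def bichromatic_pairs_def)
    show "bichromatic_pairs n c \<subseteq> (\<lambda>(i, j). {i, j}) ` L"
    proof
      fix d assume "d \<in> bichromatic_pairs n c"
      then obtain i j where ij: "d = {i, j}" "i < n" "j < n" "c i \<noteq> c j"
        by (auto simp: bichromatic_pairs_def)
      then have "(i, j) \<in> L \<or> (j, i) \<in> L" by (auto simp: L_def neq_iff)
      then show "d \<in> (\<lambda>(i, j). {i, j}) ` L" using ij by force
    qed
  qed
  ultimately have cardL: "card (bichromatic_pairs n c) = card L" by (metis card_image)
  \<comment> \<open>Bichromatic pairs in both orders, and the monochromatic pairs \<open>?E\<close>
    including the diagonal.\<close>
  have split: "{..<n} \<times> {..<n} = (L \<union> prod.swap ` L) \<union> ?E"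
  proof (intro equalityI subsetI)
    fix z assume "z \<in> {..<n} \<times> {..<n}"
    then obtain i j where z: "z = (i, j)" "i < n" "j < n" by auto
    then have "c i = c j \<or> (i, j) \<in> L \<or> (j, i) \<in> L"
      by (cases i j rule: linorder_cases) (auto simp: L_def)
    then show "z \<in> (L \<union> prod.swap ` L) \<union> ?E" using z by (force simp: M_def)
  qed (auto simp: L_def M_def)
  have "n * n = card ({..<n} \<times> {..<n})" by simp
  also have "\<dots> = card L + card (prod.swap ` L) + card ?E"
    unfolding split
    by (subst card_Un_disjoint, use finL finM in \<open>auto simp: L_def M_def\<close>)
       (subst card_Un_disjoint, use finL in \<open>auto simp: L_def\<close>)
  also have "card (prod.swap ` L) = card L" by (simp add: card_image)
  also have "card ?E = (\<Sum>i<n. card (M (c i)))" using finM by simp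
  also have "\<dots> = (\<Sum>v\<in>UNIV. (card (M v))\<^sup>2)"
    using sum.group[of "{..<n}" UNIV c "\<lambda>i. card (M (c i))"] card_UNIV_klein_four(1)
    by (simp add: M_def power2_eq_square)
  finally have total: "n\<^sup>2 = 2 * card L + (\<Sum>v\<in>UNIV. (card (M v))\<^sup>2)"
    by (simp add: power2_eq_square)
  have "n = (\<Sum>v\<in>UNIV. card (M v))"
    using sum.group[of "{..<n}" UNIV c "\<lambda>i. 1 :: nat"] card_UNIV_klein_four(1)
    by (simp add: M_def)
  then have "real n = (\<Sum>v\<in>UNIV. real (card (M v)))" by (metis of_nat_sum)
  \<comment> \<open>Cauchy-Schwarz for the class sizes: expand their squared deviations from the
    mean \<open>n / 4\<close>, scaled by 4 to clear the fraction.\<close>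
  moreover have "0 \<le> (\<Sum>v\<in>(UNIV :: klein_four set). (4 * real (card (M v)) - real n)\<^sup>2)"
    by (intro sum_nonneg) simp
  moreover have "\<dots> = 16 * (\<Sum>v\<in>UNIV. (real (card (M v)))\<^sup>2)
      - 8 * real n * (\<Sum>v\<in>UNIV. real (card (M v))) + 4 * (real n)\<^sup>2"
    by (simp add: power2_diff sum.distrib sum_subtractf sum_distrib_left card_UNIV_klein_four
        power_mult_distrib algebra_simps)
  ultimately have "(real n)\<^sup>2 \<le> 4 * (\<Sum>v\<in>UNIV. (real (card (M v)))\<^sup>2)"
    by (simp add: power2_eq_square)
  then have "real (n\<^sup>2) \<le> real (4 * (\<Sum>v\<in>UNIV. (card (M v))\<^sup>2))" by simp
  then have "n\<^sup>2 \<le> 4 * (\<Sum>v\<in>UNIV. (card (M v))\<^sup>2)" by (simp only: of_nat_le_iff)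
  then show ?thesis using total cardL by linarith
qed

section \<open>Choice of the color and the dimension bound\<close>

theorem theorem3:
  fixes n :: nat and c :: "nat \<Rightarrow> klein_four"
  assumes "n \<ge> 3"
    and "polygon_coloring n c"
  shows "\<exists>S :: nat set. finite S \<and>
           int (card S) \<le> \<lfloor>real n * (3 * real n - 8) / 16\<rfloor> \<and>
           graph_embeds (color_graph n c) (hypercube S)"
proof -
  \<comment> \<open>All diagonals that a compatible triangulation can use lie in
    \<open>D\<close>.\<close>
  define D where "D = bichromatic_pairs n c - polygon_sides n"
  have finD: "finite D" by (simp add: D_def finite_bichromatic_pairs)
  have "polygon_sides n \<subseteq> bichromatic_pairs n c"
  proof
    fix s assume s: "s \<in> polygon_sides n"
    then obtain i where i: "i < n" "s = {i, Suc i mod n}" by (auto simp: polygon_sides_def)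
    moreover have "c i \<noteq> c (Suc i mod n)"
      using assms(2) s i unfolding polygon_coloring_def properly_colored_def by blast
    moreover have "Suc i mod n < n" using i by simp
    ultimately show "s \<in> bichromatic_pairs n c" unfolding bichromatic_pairs_def by blast
  qed
  then have "card D + n = card (bichromatic_pairs n c)"
    using card_polygon_sides[OF assms(1)] finite_bichromatic_pairs[of n c]
    unfolding D_def by (metis card_Diff_subset card_mono finite_subset le_add_diff_inverse2)
  then have cardD: "8 * card D + 8 * n \<le> 3 * n\<^sup>2"
    using card_bichromatic_pairs[of n c] by simp
  have two: "card (- c ` d) = 2" if "d \<in> D" for d
  proof -
    obtain i j where "d = {i, j}" "c i \<noteq> c j"
      using \<open>d \<in> D\<close> unfolding D_def bichromatic_pairs_def by blast
    then have "card (c ` d) = 2" by simp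
    then show ?thesis using card_UNIV_klein_four
      by (simp add: card_Diff_subset Compl_eq_Diff_UNIV finite_subset[OF subset_UNIV])
  qed
  \<comment> \<open>Double counting of the pairs of a color and a diagonal avoiding it.\<close>
  have "(\<Sum>v\<in>UNIV. card (avoiding c v D)) = (\<Sum>d\<in>D. card (- c ` d))"
    unfolding avoiding_def using finD card_UNIV_klein_four(1)
    by (intro sum_multicount_gen) (auto intro!: arg_cong[where f = card])
  then have sum: "(\<Sum>v\<in>UNIV. card (avoiding c v D)) = 2 * card D" using two by simp
  \<comment> \<open>Averaging: four colors share a total of \<open>2 * card D\<close>, so some color
    gets at most half of \<open>card D\<close>.\<close>
  obtain v where v: "2 * card (avoiding c v D) \<le> card D"
  proof (rule ccontr)
    assume "\<not> thesis"
    then have "card D < 2 * card (avoiding c v D)" for v using that not_le by blast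
    then have "(\<Sum>v\<in>(UNIV :: klein_four set). card D) < (\<Sum>v\<in>UNIV. 2 * card (avoiding c v D))"
      by (intro sum_strict_mono) (auto simp: card_UNIV_klein_four)
    then show False
      using sum card_UNIV_klein_four by (simp flip: sum_distrib_left)
  qed
  define W where "W = avoiding c v D"
  have finW: "finite W" using finD by (simp add: W_def avoiding_def)
  \<comment> \<open>The cube is to be indexed by natural numbers, so the diagonals in
    \<open>W\<close> are relabeled; injectivity of \<open>g\<close> on \<open>W\<close> preserves
    symmetric differences.\<close>
  obtain g :: "nat set \<Rightarrow> nat" where g: "inj_on g W"
    using finite_imp_inj_to_nat_seg[OF finW] by blast
  let ?f = "\<lambda>T. g ` avoiding c v T"
  have sub: "avoiding c v T \<subseteq> W" if "T \<in> compatible_triangulations n c" for T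
  proof -
    have "T \<subseteq> D"
    proof
      fix d assume d: "d \<in> T"
      have "d \<in> polygon_diagonals n" "properly_colored c T"
        using d that by (auto simp: compatible_triangulations_def triangulation_def)
      then show "d \<in> D"
        using d by (elim diagonalE) (auto simp: D_def bichromatic_pairs_def properly_colored_def)
    qed
    then show ?thesis by (auto simp: W_def avoiding_def)
  qed
  have inj: "inj_on ?f (compatible_triangulations n c)"
    using inj_on_avoiding[OF assms(2), of v] sub inj_on_image_eq_iff[OF g]
    by (simp add: inj_on_def)
  have edge: "is_singleton (sym_diff (?f T) (?f T'))"
    if T: "T \<in> compatible_triangulations n c" "T' \<in> compatible_triangulations n c" "flip n T T'" for T T'
  proof -
    have "sym_diff (?f T) (?f T') = g ` sym_diff (avoiding c v T) (avoiding c v T')"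
      unfolding image_Un using sub[OF T(1)] sub[OF T(2)]
      by (subst (1 2) inj_on_image_set_diff[OF g]) auto
    then show ?thesis
      using flip_avoiding[OF assms(2) T, of v] by (auto simp: is_singleton_def)
  qed
  have "graph_embeds (color_graph n c) (hypercube (g ` W))"
  proof (rule graph_embeds_if_inj_on[of ?f])
    fix e assume "e \<in> snd (color_graph n c)"
    then obtain T T' where T: "e = {T, T'}" "T \<in> compatible_triangulations n c"
      "T' \<in> compatible_triangulations n c" "flip n T T'"
      by (auto simp: color_graph_def)
    then have "?f ` e = {?f T, ?f T'}" "?f T \<in> Pow (g ` W)" "?f T' \<in> Pow (g ` W)"
      using sub by auto
    then show "?f ` e \<in> snd (hypercube (g ` W))"
      using edge[OF T(2-4)] unfolding hypercube_def snd_conv by blast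
  qed (use inj sub in \<open>auto simp: color_graph_def hypercube_def\<close>)
  moreover have "int (card (g ` W)) \<le> \<lfloor>real n * (3 * real n - 8) / 16\<rfloor>"
  proof -
    \<comment> \<open>The factor 16 is the 8 of the pair count doubled by the choice of
      \<open>v\<close>; as \<open>card W\<close> is an integer, the floor costs nothing.\<close>
    have "16 * card W + 8 * n \<le> 3 * n\<^sup>2" using v cardD by (simp add: W_def)
    then have "real (16 * card W + 8 * n) \<le> real (3 * n\<^sup>2)" by (simp only: of_nat_le_iff)
    then have "real (card W) \<le> real n * (3 * real n - 8) / 16"
      by (simp add: power2_eq_square field_simps)
    then show ?thesis using g by (simp add: card_image le_floor_iff)
  qed
  ultimately show ?thesis using finW by blast
qed

end
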